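(* Let $A$ be an associative algebra over a field $\mathbb{K}$, let $\sigma:A\to A$ be a $\mathbb{K}$-linear multiplicative map, and let $R:A\to A$ be a $\sigma$-twisted Rota-Baxter operator on $A$. Put $R^\sigma:=\sigma\circ R$. Then $(A,R,R^\sigma)$ is a Rota-Baxter system.
   Context: Algebras are associative, not necessarily unital, over a field $\mathbb{K}$. For a multiplicative map $\sigma:A\to A$ (i.e. $\sigma(ab)=\sigma(a)\sigma(b)$), a $\mathbb{K}$-linear operator $R:A\to A$ is a $\sigma$-twisted Rota-Baxter operator if, for all $a,b\in A$, $$R(a)R(b)=R\big(R(a)b+a\,R^\sigma(b)\big),\qquad R^\sigma:=\sigma\circ R.$$ A Rota-Baxter system is a triple $(A,R,S)$ consisting of an algebra $A$ and two $\mathbb{K}$-linear operators $R,S:A\to A$ such that, for all $a,b\in A$, $$R(a)R(b)=R\big(R(a)b+aS(b)\big),\qquad S(a)S(b)=S\big(R(a)b+aS(b)\big).$$ *)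

theory Defs
  imports Complex_Main
begin

(* The class ring provides an associative multiplication without requiring a unit. *)
locale nonunital_algebra = vector_space scale
  for scale :: "'k::field \<Rightarrow> 'a::ring \<Rightarrow> 'a" (infixr \<open>*s\<close> 75) +
  assumes scale_mult_left: "(c *s a) * b = c *s (a * b)"
    and scale_mult_right: "a * (c *s b) = c *s (a * b)"

definition multiplicative_map :: "('a::times \<Rightarrow> 'a) \<Rightarrow> bool" where
  "multiplicative_map \<sigma> \<longleftrightarrow> (\<forall>a b. \<sigma> (a * b) = \<sigma> a * \<sigma> b)"

locale twisted_rota_baxter_operator =
  nonunital_algebra scale + Vector_Spaces.linear scale scale R
  for scale :: "'k::field \<Rightarrow> 'a::ring \<Rightarrow> 'a"
    and \<sigma> :: "'a \<Rightarrow> 'a"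
    and R :: "'a \<Rightarrow> 'a" +
  assumes twist_multiplicative: "multiplicative_map \<sigma>"
    and twisted_rota_baxter: "R a * R b = R (R a * b + a * (\<sigma> \<circ> R) b)"

locale rota_baxter_system =
  nonunital_algebra scale + R: Vector_Spaces.linear scale scale R
    + S: Vector_Spaces.linear scale scale S
  for scale :: "'k::field \<Rightarrow> 'a::ring \<Rightarrow> 'a"
    and R :: "'a \<Rightarrow> 'a"
    and S :: "'a \<Rightarrow> 'a" +
  assumes rota_baxter_left: "R a * R b = R (R a * b + a * S b)"
    and rota_baxter_right: "S a * S b = S (R a * b + a * S b)"

end

theory Submission imports Defs begin

text \<open>With \<open>S = \<sigma> \<circ> R\<close>, the first identity of a Rota-Baxter system
  is literally the twisted Rota-Baxter identity, and the second is its image under \<sigma>: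
  multiplicativity splits the left side into \<open>S a * S b\<close>, while on the right \<sigma>
  merges with the outer \<open>R\<close> into \<open>S\<close>.\<close>

theorem lemma4p2:
  fixes scale :: "'k::field \<Rightarrow> 'a::ring \<Rightarrow> 'a"
    and \<sigma> R :: "'a \<Rightarrow> 'a"
  assumes "nonunital_algebra scale"
    and "Vector_Spaces.linear scale scale \<sigma>"
    and "multiplicative_map \<sigma>"
    and "twisted_rota_baxter_operator scale \<sigma> R"
  shows "rota_baxter_system scale R (\<sigma> \<circ> R)"
proof -
  interpret R: twisted_rota_baxter_operator scale \<sigma> R by fact
  \<comment> \<open>Linearity of \<sigma> enters only here: a system requires its second operator to
    be linear too.\<close>
  have lin: "Vector_Spaces.linear scale scale (\<sigma> \<circ> R)"
    by (rule Vector_Spaces.linear_compose[OF R.linear_axioms assms(2)])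
  have mult: "\<sigma> (a * b) = \<sigma> a * \<sigma> b" for a b
    using assms(3) by (simp add: multiplicative_map_def)
  show ?thesis
  proof (rule rota_baxter_system.intro[OF assms(1) R.linear_axioms lin],
      rule rota_baxter_system_axioms.intro)
    fix a b
    show "R a * R b = R (R a * b + a * (\<sigma> \<circ> R) b)"
      by (rule R.twisted_rota_baxter)
    \<comment> \<open>Apply \<sigma> to both sides of the identity just shown; the argument of the
      outer \<open>R\<close> stays untouched.\<close>
    then show "(\<sigma> \<circ> R) a * (\<sigma> \<circ> R) b = (\<sigma> \<circ> R) (R a * b + a * (\<sigma> \<circ> R) b)"
      by (metis comp_apply mult)
  qed
qed

end
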